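(* Let $\delta\in(0,1/2)$. Assume that $M,N\colon G\to\mathbb C$ satisfy $\Psi_M\Psi_{N,N}\ne0$ and $\beta(N)\le\frac\delta4\beta(M)$. Then, for $\alpha\in\mathbb C$, the maximum of $\beta(M+\alpha N)$ occurs for $$\alpha=\alpha_1:=\frac{\overline{\Psi_M}\Psi_{M,N}-\overline{\Psi_N}\Psi_{M,M}}{\overline{\Psi_N}\,\overline{\Psi_{M,N}}-\overline{\Psi_M}\Psi_{N,N}}$$ and is $$\beta(M+\alpha_1N)=\frac{|\Psi_N|^2\Psi_{M,M}+|\Psi_M|^2\Psi_{N,N}-2\mathrm{Re}(\overline{\Psi_M}\Psi_N\Psi_{M,N})}{\Psi_{M,M}\Psi_{N,N}-|\Psi_{M,N}|^2}=\beta(M)+\frac{|\overline{\Psi_M}\Psi_{M,N}-\overline{\Psi_N}\Psi_{M,M}|^2}{\Psi_{M,M}(\Psi_{M,M}\Psi_{N,N}-|\Psi_{M,N}|^2)},$$ the denominators in these expressions for $\beta(M+\alpha_1N)$ being positive. Furthermore: (i) If $|\Psi_{M,N}|^2\ge\delta\,\Psi_{M,M}\Psi_{N,N}$, then $\beta(M+\alpha_1N)-\beta(M)\ge\frac\delta4\beta(M)$. (ii) If $|\Psi_{M,N}|^2\le\delta\,\Psi_{M,M}\Psi_{N,N}$, then $\beta(M+\alpha N)-\beta(M)\le5\delta\,\beta(M)$ for every $\alpha\in\mathbb C$.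
   Context: $G$ is an (indexing) set, $L\colon G\to\mathbb C$ is a function, and $w\colon G\to[0,\infty)$ is a weight function, not identically $0$. For $f\colon G\to\mathbb C$ put $\mathbb E^w_{\pi\in G}f(\pi):=\frac{\sum_{\pi\in G}w(\pi)f(\pi)}{\sum_{\pi\in G}w(\pi)}$. For $M,N\colon G\to\mathbb C$ define $\Psi_M:=\mathbb E^w_{\pi\in G}L(\pi)M(\pi)$, $\Psi_{M,N}:=\mathbb E^w_{\pi\in G}L(\pi)M(\pi)\overline{L(\pi)N(\pi)}$, and $\beta(M):=|\Psi_M|^2/\Psi_{M,M}$ if $\Psi_{M,M}\ne0$, $\beta(M):=0$ if $\Psi_{M,M}=0$. It is assumed that the series $\sum_\pi w(\pi)$ and $\sum_\pi w(\pi)|L(\pi)M(\pi)|^2$ converge for every function $M$ considered (automatic if $G$ is finite). *)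

theory Defs
  imports "HOL-Analysis.Analysis"
begin

definition wmean :: "'a set \<Rightarrow> ('a \<Rightarrow> real) \<Rightarrow> ('a \<Rightarrow> complex) \<Rightarrow> complex" where
  "wmean G w f =
     (\<Sum>\<^sub>\<infinity>p\<in>G. complex_of_real (w p) * f p) / complex_of_real (\<Sum>\<^sub>\<infinity>p\<in>G. w p)"

definition Psi :: "'a set \<Rightarrow> ('a \<Rightarrow> real) \<Rightarrow> ('a \<Rightarrow> complex) \<Rightarrow> ('a \<Rightarrow> complex) \<Rightarrow> complex" where
  "Psi G w L M = wmean G w (\<lambda>p. L p * M p)"

definition Psi2 ::
  "'a set \<Rightarrow> ('a \<Rightarrow> real) \<Rightarrow> ('a \<Rightarrow> complex) \<Rightarrow> ('a \<Rightarrow> complex) \<Rightarrow> ('a \<Rightarrow> complex) \<Rightarrow> complex" where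
  "Psi2 G w L M N = wmean G w (\<lambda>p. L p * M p * cnj (L p * N p))"

lemma infsum_of_real_complex:
  "(\<Sum>\<^sub>\<infinity>p\<in>G. complex_of_real (f p)) = complex_of_real (\<Sum>\<^sub>\<infinity>p\<in>G. f p)"
proof (rule infsum_bounded_linear_strong[OF _ bounded_linear_of_real])
  show "(\<lambda>p. complex_of_real (f p)) summable_on G \<longleftrightarrow> f summable_on G"
    using summable_on_Re[of "\<lambda>p. complex_of_real (f p)" G] summable_on_of_real[of f G] by auto
qed

(* Psi2 G w L M M is real and, for nonnegative w, nonnegative; hence taking its real part in
   real-valued expressions loses nothing. *)
lemma Psi2_self:
  "Psi2 G w L M M =
     complex_of_real ((\<Sum>\<^sub>\<infinity>p\<in>G. w p * (cmod (L p * M p))\<^sup>2) / (\<Sum>\<^sub>\<infinity>p\<in>G. w p))"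
proof -
  have "complex_of_real (w p) * (L p * M p * cnj (L p * M p)) =
          complex_of_real (w p * (cmod (L p * M p))\<^sup>2)" for p
    by (simp only: complex_norm_square of_real_mult)
  then show ?thesis
    by (simp only: Psi2_def wmean_def infsum_of_real_complex of_real_divide)
qed

lemma of_real_Re_Psi2_self: "complex_of_real (Re (Psi2 G w L M M)) = Psi2 G w L M M"
  by (simp only: Psi2_self Re_complex_of_real)

lemma Re_Psi2_self_nonneg:
  assumes "\<And>p. p \<in> G \<Longrightarrow> 0 \<le> w p"
  shows "0 \<le> Re (Psi2 G w L M M)"
  unfolding Psi2_self Re_complex_of_real
  by (intro divide_nonneg_nonneg infsum_nonneg mult_nonneg_nonneg assms zero_le_power2)

definition beta :: "'a set \<Rightarrow> ('a \<Rightarrow> real) \<Rightarrow> ('a \<Rightarrow> complex) \<Rightarrow> ('a \<Rightarrow> complex) \<Rightarrow> real" where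
  "beta G w L M =
     (if Psi2 G w L M M \<noteq> 0 then (cmod (Psi G w L M))\<^sup>2 / Re (Psi2 G w L M M) else 0)"

end

theory Submission
  imports Defs
begin

text \<open>
  Write \<open>f\<close> for the quadratic form \<open>Psi2\<close> of \<open>M + x N\<close> as a function of \<open>x\<close>. The linear form
  \<open>Psi\<close> satisfies \<open>\<bar>Psi\<bar>\<^sup>2 \<le> Psi2\<close> by Cauchy--Schwarz; taking \<open>x = - Psi2 M N / Psi2 N N\<close>
  shows that the Gram determinant \<open>D\<close> is nonnegative and that \<open>D = 0\<close> would force
  \<open>beta N \<ge> beta M\<close>, which the hypothesis excludes. With \<open>V\<close> the numerator in the formula for
  the maximum, the maximum is then read off from a Lagrange-type identity expressing
  \<open>f V - D \<bar>Psi (M + x N)\<bar>\<^sup>2\<close> as the squared modulus of an affine function of \<open>x\<close>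
  that vanishes at \<open>\<alpha>\<^sub>1\<close>. In (i) and (ii), the hypothesis gives
  \<open>\<bar>Psi N\<bar> Psi2 M M \<le> (1/2) \<bar>Psi M\<bar> sqrt (\<delta> Psi2 M M Psi2 N N)\<close>, so the excess is controlled
  by the triangle inequality.
\<close>

section \<open>Algebra of a two-by-two Gram matrix and a linear form\<close>

text \<open>Cauchy--Schwarz with explicit remainder for the Gram matrix
  \<open>[[A, c], [cnj c, B]]\<close>: the first factor is its form at the coefficients
  \<open>(1, x)\<close>, the second the adjugate form at \<open>(a, b)\<close>.\<close>

lemma rayleigh_identity:
  fixes a b c x :: complex and A B :: real
  shows "(A + 2 * Re (cnj x * c) + (cmod x)\<^sup>2 * B) *
      ((cmod b)\<^sup>2 * A + (cmod a)\<^sup>2 * B - 2 * Re (cnj a * b * c)) =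
    (A * B - (cmod c)\<^sup>2) * (cmod (a + x * b))\<^sup>2 +
      (cmod (x * (cnj b * cnj c - cnj a * B) - (cnj a * c - cnj b * A)))\<^sup>2"
  unfolding cmod_power2 by (simp add: power2_eq_square algebra_simps)

text \<open>This is the case \<open>x = 0\<close> of \<open>rayleigh_identity\<close>; dividing by
  \<open>A\<close> times the determinant splits the maximum into the value at \<open>M\<close> and
  the excess.\<close>

lemma rayleigh_excess_identity:
  fixes a b c :: complex and A B :: real
  shows "A * ((cmod b)\<^sup>2 * A + (cmod a)\<^sup>2 * B - 2 * Re (cnj a * b * c)) =
    (cmod a)\<^sup>2 * (A * B - (cmod c)\<^sup>2) + (cmod (cnj a * c - cnj b * A))\<^sup>2"
  unfolding cmod_power2 by (simp add: power2_eq_square algebra_simps)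

lemma gram_determinant_pos:
  fixes a b c :: complex and A B :: real
  assumes "0 \<le> A" "0 < B"
    and strict: "(cmod b)\<^sup>2 * A < (cmod a)\<^sup>2 * B"
    and CS: "\<And>x. (cmod (a + x * b))\<^sup>2 \<le> A + 2 * Re (cnj x * c) + (cmod x)\<^sup>2 * B"
  shows "0 < A * B - (cmod c)\<^sup>2"
    and "cnj b * cnj c - cnj a * B \<noteq> 0"
proof -
  \<comment> \<open>Minimiser of the form on the right of \<open>CS\<close>: it makes
    \<open>M + x N\<close> orthogonal to \<open>N\<close>, so the square completed below vanishes
    and only the determinant is left.\<close>
  define x where "x = - c / of_real B"
  have xB: "x * B = - c"
    using \<open>0 < B\<close> by (simp add: x_def)
  have "B * (A + 2 * Re (cnj x * c) + (cmod x)\<^sup>2 * B) =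
      A * B - (cmod c)\<^sup>2 + (cmod (x * B + c))\<^sup>2"
    unfolding cmod_power2 by (simp add: power2_eq_square algebra_simps)
  then have D: "B * (A + 2 * Re (cnj x * c) + (cmod x)\<^sup>2 * B) = A * B - (cmod c)\<^sup>2"
    by (simp add: xB)
  have le: "B * (cmod (a + x * b))\<^sup>2 \<le> A * B - (cmod c)\<^sup>2"
    using mult_left_mono[OF CS[of x] less_imp_le[OF \<open>0 < B\<close>]] unfolding D .
  moreover have "0 \<le> B * (cmod (a + x * b))\<^sup>2"
    using \<open>0 < B\<close> by simp
  ultimately have D_nonneg: "0 \<le> A * B - (cmod c)\<^sup>2"
    by linarith
  \<comment> \<open>This yields both conclusions: the conjugate of \<open>b * c - a * B\<close> is
    the denominator of \<alpha>_1, and \<open>a * B - b * c\<close> is \<open>B\<close> times the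
    linear form at the minimiser. Equality would give, via \<open>\<bar>c\<bar>^2 \<le> A B\<close>,
    the reverse of \<open>strict\<close>.\<close>
  have ne: "a * B \<noteq> b * c"
  proof
    assume eq: "a * B = b * c"
    have "(cmod (a * B))\<^sup>2 = (cmod (b * c))\<^sup>2"
      by (simp only: eq)
    then have "((cmod a)\<^sup>2 * B) * B = (cmod b)\<^sup>2 * (cmod c)\<^sup>2"
      by (simp add: norm_mult power_mult_distrib power2_eq_square[of B] mult_ac)
    also have "\<dots> \<le> (cmod b)\<^sup>2 * (A * B)"
      using D_nonneg by (intro mult_left_mono) auto
    finally have "((cmod a)\<^sup>2 * B) * B \<le> ((cmod b)\<^sup>2 * A) * B"
      by (simp add: mult_ac)
    then show False
      using strict \<open>0 < B\<close> by simp
  qed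
  then show "cnj b * cnj c - cnj a * B \<noteq> 0"
    by (metis complex_cnj_complex_of_real complex_cnj_mult complex_cnj_cancel_iff
        right_minus_eq)
  have "(a + x * b) * B = a * B - b * c"
    using xB by (simp add: algebra_simps)
  with ne have "a + x * b \<noteq> 0"
    by auto
  then have "0 < B * (cmod (a + x * b))\<^sup>2"
    using \<open>0 < B\<close> by simp
  with le show "0 < A * B - (cmod c)\<^sup>2"
    by linarith
qed

text \<open>The remainder square in \<open>rayleigh_identity\<close> is nonnegative, which gives the
  bound, and its base is affine in \<open>x\<close> with root \<open>x\<^sub>1\<close>, which gives
  attainment.\<close>

lemma rayleigh_maximum:
  fixes a b c x\<^sub>1 :: complex and A B :: real
  defines "D \<equiv> A * B - (cmod c)\<^sup>2"
    and "V \<equiv> (cmod b)\<^sup>2 * A + (cmod a)\<^sup>2 * B - 2 * Re (cnj a * b * c)"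
    and "Q \<equiv> \<lambda>x. A + 2 * Re (cnj x * c) + (cmod x)\<^sup>2 * B"
  assumes "0 < D" and Q: "\<And>x. 0 < Q x"
    and d: "cnj b * cnj c - cnj a * B \<noteq> 0"
    and x\<^sub>1: "x\<^sub>1 = (cnj a * c - cnj b * A) / (cnj b * cnj c - cnj a * B)"
  shows "(cmod (a + x * b))\<^sup>2 / Q x \<le> V / D"
    and "(cmod (a + x\<^sub>1 * b))\<^sup>2 / Q x\<^sub>1 = V / D"
proof -
  have *: "Q x * V = D * (cmod (a + x * b))\<^sup>2 +
      (cmod (x * (cnj b * cnj c - cnj a * B) - (cnj a * c - cnj b * A)))\<^sup>2" for x
    unfolding Q_def V_def D_def by (rule rayleigh_identity)
  have "D * (cmod (a + x * b))\<^sup>2 \<le> Q x * V"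
    by (simp add: *)
  then show "(cmod (a + x * b))\<^sup>2 / Q x \<le> V / D"
    using \<open>0 < D\<close> Q[of x] by (simp add: field_simps)
  have "x\<^sub>1 * (cnj b * cnj c - cnj a * B) - (cnj a * c - cnj b * A) = 0"
    using d by (simp add: x\<^sub>1)
  then have "Q x\<^sub>1 * V = D * (cmod (a + x\<^sub>1 * b))\<^sup>2"
    by (simp only: *) simp
  then show "(cmod (a + x\<^sub>1 * b))\<^sup>2 / Q x\<^sub>1 = V / D"
    using \<open>0 < D\<close> Q[of x\<^sub>1] by (simp add: field_simps)
qed

lemma rayleigh_excess_bounds:
  fixes a b c :: complex and A B \<delta> :: real
  defines "D \<equiv> A * B - (cmod c)\<^sup>2"
    and "E \<equiv> (cmod (cnj a * c - cnj b * A))\<^sup>2"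
  assumes "0 < A" "0 < B" "0 < D" "0 < \<delta>" "\<delta> < 1 / 2"
    and small: "(cmod b)\<^sup>2 * A \<le> \<delta> / 4 * ((cmod a)\<^sup>2 * B)"
  shows "\<delta> * A * B \<le> (cmod c)\<^sup>2 \<Longrightarrow> \<delta> / 4 * ((cmod a)\<^sup>2 / A) \<le> E / (A * D)"
    and "(cmod c)\<^sup>2 \<le> \<delta> * A * B \<Longrightarrow> E / (A * D) \<le> 5 * \<delta> * ((cmod a)\<^sup>2 / A)"
proof -
  \<comment> \<open>The value of \<open>cmod (cnj a * c)\<close> at the threshold between the two
    cases; \<open>small\<close> bounds the competing term \<open>cmod (cnj b * A)\<close> by half of
    it.\<close>
  define s where "s = cmod a * sqrt (\<delta> * A * B)"
  have "0 \<le> \<delta> * A * B"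
    using \<open>0 < \<delta>\<close> \<open>0 < A\<close> \<open>0 < B\<close> by simp
  then have s_nonneg: "0 \<le> s" and s2: "s\<^sup>2 = (cmod a)\<^sup>2 * (\<delta> * A * B)"
    by (simp_all only: s_def power_mult_distrib real_sqrt_pow2 mult_nonneg_nonneg
        norm_ge_zero real_sqrt_ge_zero)
  have ac: "cmod (cnj a * c) = cmod a * cmod c" and bA: "cmod (cnj b * A) = cmod b * A"
    using \<open>0 < A\<close> by (auto simp: norm_mult)
  have "(cmod b * A)\<^sup>2 = ((cmod b)\<^sup>2 * A) * A"
    by (simp add: power2_eq_square)
  also have "\<dots> \<le> (\<delta> / 4 * ((cmod a)\<^sup>2 * B)) * A"
    using small less_imp_le[OF \<open>0 < A\<close>] by (rule mult_right_mono)
  also have "\<dots> = (s / 2)\<^sup>2"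
    by (simp only: power_divide s2) (simp add: power2_eq_square)
  finally have b_le: "cmod b * A \<le> s / 2"
    by (rule power2_le_imp_le) (use s_nonneg in simp)
  show "\<delta> / 4 * ((cmod a)\<^sup>2 / A) \<le> E / (A * D)" if "\<delta> * A * B \<le> (cmod c)\<^sup>2"
  proof -
    have "s\<^sup>2 \<le> (cmod a * cmod c)\<^sup>2"
      unfolding s2 power_mult_distrib using that by (intro mult_left_mono) auto
    then have "s \<le> cmod a * cmod c"
      by (rule power2_le_imp_le) simp
    then have "s / 2 \<le> cmod (cnj a * c - cnj b * A)"
      using norm_triangle_ineq2[of "cnj a * c" "cnj b * A"] b_le ac bA by linarith
    then have "(s / 2)\<^sup>2 \<le> E"
      unfolding E_def using s_nonneg by (intro power_mono) auto
    \<comment> \<open>The factor 1/4 is the square of \<open>1 - 1/2\<close> from the reverse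
      triangle inequality; \<open>D \<le> A * B\<close> does the rest.\<close>
    have "\<delta> / 4 * (cmod a)\<^sup>2 * D \<le> \<delta> / 4 * (cmod a)\<^sup>2 * (A * B)"
      using \<open>0 < \<delta>\<close> by (intro mult_left_mono) (auto simp: D_def)
    also have "\<dots> = (s / 2)\<^sup>2"
      by (simp only: power_divide s2) (simp add: power2_eq_square)
    finally have "\<delta> / 4 * (cmod a)\<^sup>2 * D \<le> E"
      using \<open>(s / 2)\<^sup>2 \<le> E\<close> by linarith
    then have "\<delta> / 4 * (cmod a)\<^sup>2 * D / (A * D) \<le> E / (A * D)"
      using \<open>0 < A\<close> \<open>0 < D\<close> by (intro divide_right_mono) auto
    then show ?thesis
      using \<open>0 < D\<close> by simp
  qed
  show "E / (A * D) \<le> 5 * \<delta> * ((cmod a)\<^sup>2 / A)" if le: "(cmod c)\<^sup>2 \<le> \<delta> * A * B"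
  proof -
    have "(cmod a * cmod c)\<^sup>2 \<le> s\<^sup>2"
      unfolding s2 power_mult_distrib using le by (intro mult_left_mono) auto
    then have "cmod a * cmod c \<le> s"
      using s_nonneg by (rule power2_le_imp_le)
    then have "cmod (cnj a * c - cnj b * A) \<le> 3 / 2 * s"
      using norm_triangle_ineq4[of "cnj a * c" "cnj b * A"] b_le ac bA by linarith
    then have "E \<le> (3 / 2 * s)\<^sup>2"
      unfolding E_def by (intro power_mono) auto
    \<comment> \<open>One factor 1/2 is split off because \<delta> < 1/2 gives
      \<open>A * B / 2 \<le> D\<close>; the remaining 9/2 is rounded up to 5.\<close>
    also have "\<dots> = 9 / 2 * \<delta> * (cmod a)\<^sup>2 * (A * B / 2)"
      by (simp only: power_mult_distrib s2) (simp add: power2_eq_square)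
    also have "\<dots> \<le> 5 * \<delta> * (cmod a)\<^sup>2 * D"
    proof (rule mult_mono)
      have "\<delta> * (A * B) \<le> 1 / 2 * (A * B)"
        using \<open>\<delta> < 1 / 2\<close> \<open>0 < A\<close> \<open>0 < B\<close> by (intro mult_right_mono) auto
      then show "A * B / 2 \<le> D"
        using le by (simp add: D_def mult_ac)
      show "9 / 2 * \<delta> * (cmod a)\<^sup>2 \<le> 5 * \<delta> * (cmod a)\<^sup>2"
        using \<open>0 < \<delta>\<close> by (intro mult_right_mono) auto
    qed (use \<open>0 < \<delta>\<close> \<open>0 < A\<close> \<open>0 < B\<close> in auto)
    finally have "E / (A * D) \<le> 5 * \<delta> * (cmod a)\<^sup>2 * D / (A * D)"
      using \<open>0 < A\<close> \<open>0 < D\<close> by (intro divide_right_mono) auto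
    then show ?thesis
      using \<open>0 < D\<close> by simp
  qed
qed

section \<open>Summability, sesquilinearity and Cauchy--Schwarz for weighted means\<close>

lemma weighted_inner_summable:
  fixes f g :: "'a \<Rightarrow> complex"
  assumes w: "\<And>p. p \<in> G \<Longrightarrow> 0 \<le> w p"
    and f: "(\<lambda>p. w p * (cmod (f p))\<^sup>2) summable_on G"
    and g: "(\<lambda>p. w p * (cmod (g p))\<^sup>2) summable_on G"
  shows "(\<lambda>p. complex_of_real (w p) * (f p * cnj (g p))) summable_on G"
proof (rule abs_summable_summable, rule summable_on_comparison_test)
  show "(\<lambda>p. w p * (cmod (f p))\<^sup>2 + w p * (cmod (g p))\<^sup>2) summable_on G"
    using f g by (rule summable_on_add)
  fix p assume p: "p \<in> G"
  have "cmod (f p) * cmod (g p) \<le> (cmod (f p))\<^sup>2 + (cmod (g p))\<^sup>2"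
    using sum_squares_bound[of "cmod (f p)" "cmod (g p)"]
      mult_nonneg_nonneg[OF norm_ge_zero norm_ge_zero, of "f p" "g p"] by linarith
  then show "cmod (complex_of_real (w p) * (f p * cnj (g p)))
      \<le> w p * (cmod (f p))\<^sup>2 + w p * (cmod (g p))\<^sup>2"
    using w[OF p] mult_left_mono[of _ _ "w p"] by (simp add: norm_mult flip: distrib_left)
qed auto

lemma weighted_square_summable_add:
  fixes f g :: "'a \<Rightarrow> complex"
  assumes w: "\<And>p. p \<in> G \<Longrightarrow> 0 \<le> w p"
    and f: "(\<lambda>p. w p * (cmod (f p))\<^sup>2) summable_on G"
    and g: "(\<lambda>p. w p * (cmod (g p))\<^sup>2) summable_on G"
  shows "(\<lambda>p. w p * (cmod (f p + x * g p))\<^sup>2) summable_on G"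
proof (rule summable_on_comparison_test)
  show "(\<lambda>p. 2 * (w p * (cmod (f p))\<^sup>2) + 2 * (cmod x)\<^sup>2 * (w p * (cmod (g p))\<^sup>2)) summable_on G"
    by (intro summable_on_add summable_on_cmult_right f g)
  fix p assume p: "p \<in> G"
  have "(cmod (f p + x * g p))\<^sup>2 \<le> (cmod (f p) + cmod (x * g p))\<^sup>2"
    by (intro power_mono norm_triangle_ineq) auto
  also have "\<dots> \<le> 2 * (cmod (f p))\<^sup>2 + 2 * (cmod x)\<^sup>2 * (cmod (g p))\<^sup>2"
    using sum_squares_bound[of "cmod (f p)" "cmod (x * g p)"]
    by (simp add: power2_sum norm_mult power_mult_distrib)
  finally show "w p * (cmod (f p + x * g p))\<^sup>2
      \<le> 2 * (w p * (cmod (f p))\<^sup>2) + 2 * (cmod x)\<^sup>2 * (w p * (cmod (g p))\<^sup>2)"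
    using mult_left_mono[OF _ w[OF p]] by (fastforce simp: algebra_simps)
  show "0 \<le> w p * (cmod (f p + x * g p))\<^sup>2"
    using w[OF p] by simp
qed

lemma wmean_add_cmult:
  assumes "(\<lambda>p. complex_of_real (w p) * f p) summable_on G"
    and "(\<lambda>p. complex_of_real (w p) * g p) summable_on G"
  shows "wmean G w (\<lambda>p. f p + x * g p) = wmean G w f + x * wmean G w g"
proof -
  have "(\<Sum>\<^sub>\<infinity>p\<in>G. complex_of_real (w p) * (f p + x * g p)) =
      (\<Sum>\<^sub>\<infinity>p\<in>G. complex_of_real (w p) * f p + x * (complex_of_real (w p) * g p))"
    by (simp add: algebra_simps)
  also have "\<dots> = (\<Sum>\<^sub>\<infinity>p\<in>G. complex_of_real (w p) * f p) +
      x * (\<Sum>\<^sub>\<infinity>p\<in>G. complex_of_real (w p) * g p)"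
    by (simp add: infsum_add infsum_cmult_right' summable_on_cmult_right assms)
  finally show ?thesis
    by (simp add: wmean_def add_divide_distrib)
qed

lemma Psi2_cnj: "Psi2 G w L N M = cnj (Psi2 G w L M N)"
proof -
  have "wmean G w (\<lambda>p. cnj (L p * M p * cnj (L p * N p))) = cnj (Psi2 G w L M N)"
    unfolding Psi2_def wmean_def by (simp flip: infsum_cnj)
  then show ?thesis
    by (simp add: Psi2_def mult_ac)
qed

lemma Psi2_add_cmult:
  assumes w: "\<And>p. p \<in> G \<Longrightarrow> 0 \<le> w p"
    and M: "(\<lambda>p. w p * (cmod (L p * M p))\<^sup>2) summable_on G"
    and N: "(\<lambda>p. w p * (cmod (L p * N p))\<^sup>2) summable_on G"
  shows "Re (Psi2 G w L (\<lambda>p. M p + x * N p) (\<lambda>p. M p + x * N p)) =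
    Re (Psi2 G w L M M) + 2 * Re (cnj x * Psi2 G w L M N) + (cmod x)\<^sup>2 * Re (Psi2 G w L N N)"
proof -
  let ?K = "\<lambda>p. M p + x * N p"
  have K: "(\<lambda>p. w p * (cmod (L p * ?K p))\<^sup>2) summable_on G"
    using weighted_square_summable_add[OF w M N, of x] by (simp add: algebra_simps)
  note S = weighted_inner_summable[OF w]
  have left: "Psi2 G w L ?K P = Psi2 G w L M P + x * Psi2 G w L N P"
    if "(\<lambda>p. w p * (cmod (L p * P p))\<^sup>2) summable_on G" for P
    unfolding Psi2_def
    using wmean_add_cmult[OF S[OF _ M that] S[OF _ N that], of x] by (simp add: algebra_simps)
  have right: "Psi2 G w L P ?K = Psi2 G w L P M + cnj x * Psi2 G w L P N"
    if "(\<lambda>p. w p * (cmod (L p * P p))\<^sup>2) summable_on G" for P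
    \<comment> \<open>Conjugate symmetry turns linearity in the first argument into conjugate
      linearity in the second.\<close>
    using left[OF that] Psi2_cnj[of G w L P] by simp
  have "Psi2 G w L ?K ?K = Psi2 G w L M M + cnj x * Psi2 G w L M N +
      x * (cnj (Psi2 G w L M N) + cnj x * Psi2 G w L N N)"
    using left[OF K] right[OF M] right[OF N] Psi2_cnj[of G w L N M] by simp
  then show ?thesis
    unfolding cmod_power2 by (simp add: power2_eq_square algebra_simps)
qed

text \<open>Views the linear form as an inner product with the constant 1, so that the expansion of
  \<open>Psi2\<close> also serves for Cauchy--Schwarz.\<close>

lemma Psi2_one_right: "Psi2 G w (\<lambda>_. 1) (\<lambda>p. L p * M p) (\<lambda>_. 1) = Psi G w L M"
  by (simp add: Psi2_def Psi_def)

text \<open>The difference of the two sides is the variance of \<open>L M\<close>, the weighted mean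
  of \<open>\<bar>L M - ?m\<bar>^2\<close>. For total weight 0 both sides are 0, by the convention
  for division by zero.\<close>

lemma Psi_Cauchy_Schwarz:
  assumes w: "\<And>p. p \<in> G \<Longrightarrow> 0 \<le> w p" and W: "w summable_on G"
    and M: "(\<lambda>p. w p * (cmod (L p * M p))\<^sup>2) summable_on G"
  shows "(cmod (Psi G w L M))\<^sup>2 \<le> Re (Psi2 G w L M M)"
proof (cases "(\<Sum>\<^sub>\<infinity>p\<in>G. w p) = 0")
  case True
  then show ?thesis
    by (simp add: Psi_def Psi2_def wmean_def)
next
  case False
  let ?f = "\<lambda>p. L p * M p" and ?m = "Psi G w L M"
  have "Psi2 G w (\<lambda>_. 1) (\<lambda>_. 1) (\<lambda>_. 1) = 1"
    using False by (simp add: Psi2_self)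
  moreover have "Psi2 G w (\<lambda>_. 1) ?f ?f = Psi2 G w L M M"
    by (simp add: Psi2_def)
  moreover have "0 \<le> Re (Psi2 G w (\<lambda>_. 1) (\<lambda>p. ?f p + (- ?m) * 1) (\<lambda>p. ?f p + (- ?m) * 1))"
    using w by (rule Re_Psi2_self_nonneg)
  ultimately have "0 \<le> Re (Psi2 G w L M M) + 2 * Re (cnj (- ?m) * ?m) + (cmod (- ?m))\<^sup>2"
    using Psi2_add_cmult[of G w "\<lambda>_. 1" ?f "\<lambda>_. 1" "- ?m"] w W M
    by (simp add: Psi2_one_right)
  then show ?thesis
    unfolding cmod_power2 by (simp add: power2_eq_square)
qed

lemma Psi_add_cmult:
  assumes w: "\<And>p. p \<in> G \<Longrightarrow> 0 \<le> w p" and W: "w summable_on G"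
    and M: "(\<lambda>p. w p * (cmod (L p * M p))\<^sup>2) summable_on G"
    and N: "(\<lambda>p. w p * (cmod (L p * N p))\<^sup>2) summable_on G"
  shows "Psi G w L (\<lambda>p. M p + x * N p) = Psi G w L M + x * Psi G w L N"
proof -
  have S: "(\<lambda>p. complex_of_real (w p) * (L p * P p)) summable_on G"
    if "(\<lambda>p. w p * (cmod (L p * P p))\<^sup>2) summable_on G" for P
    \<comment> \<open>Summability of \<open>w\<close> makes the constant 1 square summable, so it
      can be paired with \<open>L P\<close>.\<close>
    using weighted_inner_summable[OF w that, of "\<lambda>_. 1"] W by simp
  show ?thesis
    unfolding Psi_def using wmean_add_cmult[OF S[OF M] S[OF N], of x]
    by (simp add: algebra_simps)
qed

text \<open>The case split in \<open>beta\<close> agrees with \<open>x / 0 = 0\<close>, so one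
  quotient formula covers both cases.\<close>

lemma beta_eq_quotient: "beta G w L M = (cmod (Psi G w L M))\<^sup>2 / Re (Psi2 G w L M M)"
  by (simp add: beta_def)

section \<open>Maximising \<open>beta\<close> along the line \<open>M + x N\<close>\<close>

theorem corollary2p10:
  fixes G :: "'a set" and w :: "'a \<Rightarrow> real" and L M N :: "'a \<Rightarrow> complex"
    and \<delta> :: real and \<alpha>\<^sub>1 :: complex
  assumes "\<And>p. p \<in> G \<Longrightarrow> 0 \<le> w p"
    and "\<exists>p\<in>G. w p \<noteq> 0"
    and "w summable_on G"
    and "(\<lambda>p. w p * (cmod (L p * M p))\<^sup>2) summable_on G"
    and "(\<lambda>p. w p * (cmod (L p * N p))\<^sup>2) summable_on G"
    and "0 < \<delta>" and "\<delta> < 1 / 2"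
    and "Psi G w L M * Psi2 G w L N N \<noteq> 0"
    and "beta G w L N \<le> \<delta> / 4 * beta G w L M"
    and "\<alpha>\<^sub>1 =
      (cnj (Psi G w L M) * Psi2 G w L M N - cnj (Psi G w L N) * Psi2 G w L M M) /
      (cnj (Psi G w L N) * cnj (Psi2 G w L M N) - cnj (Psi G w L M) * Psi2 G w L N N)"
  shows
    "cnj (Psi G w L N) * cnj (Psi2 G w L M N) - cnj (Psi G w L M) * Psi2 G w L N N \<noteq> 0 \<and>
     (\<forall>\<alpha>::complex. beta G w L (\<lambda>p. M p + \<alpha> * N p) \<le> beta G w L (\<lambda>p. M p + \<alpha>\<^sub>1 * N p)) \<and>
     beta G w L (\<lambda>p. M p + \<alpha>\<^sub>1 * N p) =
       ((cmod (Psi G w L N))\<^sup>2 * Re (Psi2 G w L M M) + (cmod (Psi G w L M))\<^sup>2 * Re (Psi2 G w L N N)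
          - 2 * Re (cnj (Psi G w L M) * Psi G w L N * Psi2 G w L M N)) /
       (Re (Psi2 G w L M M) * Re (Psi2 G w L N N) - (cmod (Psi2 G w L M N))\<^sup>2) \<and>
     beta G w L (\<lambda>p. M p + \<alpha>\<^sub>1 * N p) =
       beta G w L M +
       (cmod (cnj (Psi G w L M) * Psi2 G w L M N - cnj (Psi G w L N) * Psi2 G w L M M))\<^sup>2 /
       (Re (Psi2 G w L M M) *
         (Re (Psi2 G w L M M) * Re (Psi2 G w L N N) - (cmod (Psi2 G w L M N))\<^sup>2)) \<and>
     0 < Re (Psi2 G w L M M) * Re (Psi2 G w L N N) - (cmod (Psi2 G w L M N))\<^sup>2 \<and>
     0 < Re (Psi2 G w L M M) *
         (Re (Psi2 G w L M M) * Re (Psi2 G w L N N) - (cmod (Psi2 G w L M N))\<^sup>2) \<and>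
     ((cmod (Psi2 G w L M N))\<^sup>2 \<ge> \<delta> * Re (Psi2 G w L M M) * Re (Psi2 G w L N N) \<longrightarrow>
        beta G w L (\<lambda>p. M p + \<alpha>\<^sub>1 * N p) - beta G w L M \<ge> \<delta> / 4 * beta G w L M) \<and>
     ((cmod (Psi2 G w L M N))\<^sup>2 \<le> \<delta> * Re (Psi2 G w L M M) * Re (Psi2 G w L N N) \<longrightarrow>
        (\<forall>\<alpha>::complex. beta G w L (\<lambda>p. M p + \<alpha> * N p) - beta G w L M \<le> 5 * \<delta> * beta G w L M))"
proof -
  note w = assms(1) and W = assms(3) and M = assms(4) and N = assms(5)
  define a b c A B where "a = Psi G w L M" and "b = Psi G w L N" and "c = Psi2 G w L M N"
    and "A = Re (Psi2 G w L M M)" and "B = Re (Psi2 G w L N N)"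
  have MM: "Psi2 G w L M M = of_real A" and NN: "Psi2 G w L N N = of_real B"
    by (simp_all only: A_def B_def of_real_Re_Psi2_self)
  define Q where "Q x = A + 2 * Re (cnj x * c) + (cmod x)\<^sup>2 * B" for x
  have beta_eq: "beta G w L (\<lambda>p. M p + x * N p) = (cmod (a + x * b))\<^sup>2 / Q x" for x
    by (simp only: beta_eq_quotient Psi_add_cmult[OF w W M N] Psi2_add_cmult[OF w M N]
        Q_def a_def b_def c_def A_def B_def)
  have CS: "(cmod (a + x * b))\<^sup>2 \<le> Q x" for x
  proof -
    have "(\<lambda>p. w p * (cmod (L p * (M p + x * N p)))\<^sup>2) summable_on G"
      using weighted_square_summable_add[OF w M N, of x] by (simp add: algebra_simps)
    from Psi_Cauchy_Schwarz[OF w W this] show ?thesis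
      by (simp only: Psi_add_cmult[OF w W M N] Psi2_add_cmult[OF w M N]
          Q_def a_def b_def c_def A_def B_def)
  qed
  have "a \<noteq> 0" and "B \<noteq> 0"
    using assms(8) by (auto simp: a_def NN)
  have "0 \<le> B"
    unfolding B_def using w by (rule Re_Psi2_self_nonneg)
  with \<open>B \<noteq> 0\<close> have "0 < B"
    by simp
  \<comment> \<open>Positivity of \<open>A\<close> comes from Cauchy--Schwarz at
    \<open>x = 0\<close>, since the linear form does not vanish at \<open>M\<close>.\<close>
  have "0 < (cmod a)\<^sup>2"
    using \<open>a \<noteq> 0\<close> by simp
  also have "\<dots> \<le> A"
    using CS[of 0] by (simp add: Q_def)
  finally have "0 < A" .
  have beta_M: "beta G w L M = (cmod a)\<^sup>2 / A" and beta_N: "beta G w L N = (cmod b)\<^sup>2 / B"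
    by (simp_all only: beta_eq_quotient a_def b_def A_def B_def)
  have small: "(cmod b)\<^sup>2 * A \<le> \<delta> / 4 * ((cmod a)\<^sup>2 * B)"
    using assms(9) \<open>0 < A\<close> \<open>0 < B\<close> unfolding beta_M beta_N by (simp add: field_simps)
  also have "\<dots> < 1 * ((cmod a)\<^sup>2 * B)"
    using \<open>\<delta> < 1 / 2\<close> \<open>0 < (cmod a)\<^sup>2\<close> \<open>0 < B\<close> by (intro mult_strict_right_mono) auto
  finally have strict: "(cmod b)\<^sup>2 * A < (cmod a)\<^sup>2 * B"
    by simp
  have D: "0 < A * B - (cmod c)\<^sup>2" and d: "cnj b * cnj c - cnj a * B \<noteq> 0"
    using gram_determinant_pos[OF less_imp_le[OF \<open>0 < A\<close>] \<open>0 < B\<close> strict, of c] CS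
    by (simp_all add: Q_def)
  \<comment> \<open>Completing the square in \<open>x\<close>: with \<open>B\<close> and the
    determinant positive, the form vanishes nowhere on the line, so every quotient in
    \<open>beta_eq\<close> has a positive denominator.\<close>
  have Q_pos: "0 < Q x" for x
  proof -
    have "B * Q x = (A * B - (cmod c)\<^sup>2) + (cmod (x * B + c))\<^sup>2"
      unfolding cmod_power2 Q_def by (simp add: power2_eq_square algebra_simps)
    then have "0 < B * Q x"
      using D by (simp add: add_pos_nonneg)
    then show ?thesis
      using \<open>0 < B\<close> by (simp add: zero_less_mult_iff)
  qed
  let ?V = "((cmod b)\<^sup>2 * A + (cmod a)\<^sup>2 * B - 2 * Re (cnj a * b * c)) / (A * B - (cmod c)\<^sup>2)"
  let ?E = "(cmod (cnj a * c - cnj b * A))\<^sup>2 / (A * (A * B - (cmod c)\<^sup>2))"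
  have \<alpha>\<^sub>1: "\<alpha>\<^sub>1 = (cnj a * c - cnj b * A) / (cnj b * cnj c - cnj a * B)"
    using assms(10) by (simp only: MM NN a_def b_def c_def)
  note Max = rayleigh_maximum[OF D Q_pos[unfolded Q_def] d \<alpha>\<^sub>1]
  have V_eq: "?V = beta G w L M + ?E"
    using rayleigh_excess_identity[of A b a B c] \<open>0 < A\<close> D
    by (simp add: beta_M divide_simps) (simp add: algebra_simps)
  have max: "beta G w L (\<lambda>p. M p + x * N p) \<le> ?V" for x
    unfolding beta_eq Q_def by (rule Max(1))
  have at_max: "beta G w L (\<lambda>p. M p + \<alpha>\<^sub>1 * N p) = ?V"
    unfolding beta_eq Q_def by (rule Max(2))
  note bounds = rayleigh_excess_bounds[OF \<open>0 < A\<close> \<open>0 < B\<close> D assms(6,7) small, folded beta_M]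
  have i: "\<delta> / 4 * beta G w L M \<le> beta G w L (\<lambda>p. M p + \<alpha>\<^sub>1 * N p) - beta G w L M"
    if "\<delta> * A * B \<le> (cmod c)\<^sup>2"
    using bounds(1)[OF that] at_max V_eq by linarith
  \<comment> \<open>Bounding the maximal excess suffices, as \<open>max\<close> puts every other
    value below it.\<close>
  have ii: "beta G w L (\<lambda>p. M p + x * N p) - beta G w L M \<le> 5 * \<delta> * beta G w L M"
    if "(cmod c)\<^sup>2 \<le> \<delta> * A * B" for x
    using bounds(2)[OF that] max[of x] V_eq by linarith
  have AD: "0 < A * (A * B - (cmod c)\<^sup>2)"
    using \<open>0 < A\<close> D by simp
  have max': "beta G w L (\<lambda>p. M p + x * N p) \<le> beta G w L (\<lambda>p. M p + \<alpha>\<^sub>1 * N p)" for x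
    using max at_max by simp
  show ?thesis
    unfolding MM NN Re_complex_of_real
    unfolding a_def[symmetric] b_def[symmetric] c_def[symmetric]
    using d max' at_max at_max[unfolded V_eq] D AD i ii by blast
qed

end
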